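(* For each integer $n\ge 1$ there exists a finite number of equivalence classes of BC-processes with $n$ agents with respect to the equivalence relation $\cong_{\mathcal{G}}$ (graph equivalence).
   Context: A bounded confidence (BC) process $\mathcal{P}=(X(0),\varepsilon)$ with $n$ agents $A=\{1,\dots,n\}$ is determined by a starting configuration $X(0)=(x_1(0),\dots,x_n(0))\in\mathbb{R}^n$ and a confidence level $\varepsilon\in\mathbb{R}_{\ge 0}$. For $t\in\mathbb{N}=\{0,1,2,\dots\}$ put $I_i(t)=\{j\in A : |x_j(t)-x_i(t)|\le\varepsilon\}$, and define recursively $x_i(t+1)=\frac{1}{\# I_i(t)}\sum_{j\in I_i(t)}x_j(t)$ for all $i\in A$. The influence graph at time $t$ is the (labeled) graph $\mathcal{G}(t)=(A,E(t))$ with $E(t)=\{\{i,j\} : i,j\in A,\ i\ne j,\ |x_i(t)-x_j(t)|\le\varepsilon\}$. Two BC-processes $\mathcal{P}'=(X'(0),\varepsilon')$ and $\mathcal{P}''=(X''(0),\varepsilon'')$ with influence graphs $\mathcal{G}'(t)$ and $\mathcal{G}''(t)$ are called graph equivalent, written $\mathcal{P}'\cong_{\mathcal{G}}\mathcal{P}''$, iff $\mathcal{G}'(t)=\mathcal{G}''(t)$ for all $t\in\mathbb{N}$. *)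

theory Defs
  imports Complex_Main "HOL-Library.FuncSet"
begin

definition agents :: "nat \<Rightarrow> nat set" where
  "agents n = {1..n}"

text \<open>A configuration in \<open>\<real>\<^sup>n\<close> is an extensional function on the agents; a process with \<open>n\<close> agents
  is a pair of a starting configuration and a confidence level.\<close>

type_synonym config = "nat \<Rightarrow> real"
type_synonym bc_process = "config \<times> real"

definition bc_processes :: "nat \<Rightarrow> bc_process set" where
  "bc_processes n = (agents n \<rightarrow>\<^sub>E UNIV) \<times> {0..}"

definition neighbours :: "nat \<Rightarrow> real \<Rightarrow> config \<Rightarrow> nat \<Rightarrow> nat set" where
  "neighbours n \<epsilon> x i = {j \<in> agents n. \<bar>x j - x i\<bar> \<le> \<epsilon>}"

definition bc_step :: "nat \<Rightarrow> real \<Rightarrow> config \<Rightarrow> config" where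
  "bc_step n \<epsilon> x =
     (\<lambda>i\<in>agents n. (1 / real (card (neighbours n \<epsilon> x i))) * (\<Sum>j\<in>neighbours n \<epsilon> x i. x j))"

primrec bc_config :: "nat \<Rightarrow> bc_process \<Rightarrow> nat \<Rightarrow> config" where
  "bc_config n P 0 = fst P"
| "bc_config n P (Suc t) = bc_step n (snd P) (bc_config n P t)"

definition influence_edges :: "nat \<Rightarrow> bc_process \<Rightarrow> nat \<Rightarrow> nat set set" where
  "influence_edges n P t =
     {{i, j} | i j. i \<in> agents n \<and> j \<in> agents n \<and> i \<noteq> j \<and>
                    \<bar>bc_config n P t i - bc_config n P t j\<bar> \<le> snd P}"

definition influence_graph :: "nat \<Rightarrow> bc_process \<Rightarrow> nat \<Rightarrow> nat set \<times> nat set set" where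
  "influence_graph n P t = (agents n, influence_edges n P t)"

definition graph_equivalence :: "nat \<Rightarrow> (bc_process \<times> bc_process) set" where
  "graph_equivalence n =
     {(P, Q). P \<in> bc_processes n \<and> Q \<in> bc_processes n \<and>
              (\<forall>t. influence_graph n P t = influence_graph n Q t)}"

lemma equiv_graph_equivalence: "equiv (bc_processes n) (graph_equivalence n)"
  by (rule equivI) (auto simp: graph_equivalence_def refl_on_def sym_def trans_def)

end

theory Submission
  imports Defs
begin

text \<open>The energy \<open>\<Sum>i j. min ((x i - x j)\<^sup>2) (\<epsilon>\<^sup>2)\<close> is at most \<open>n\<^sup>2 \<epsilon>\<^sup>2\<close> and drops in each step by at
  least four times the sum of the squared displacements.  As long as the influence relation is not
  transitive, some agent is displaced by at least \<open>\<epsilon> / (n (n + 1))\<close>: consider the leftmost agent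
  \<open>p\<close> from which an agent at distance more than \<open>\<epsilon>\<close> to the right is reached in two edges.  It has no
  neighbours on its left, so if it barely moves then its neighbours are all close to it, and the
  intermediate agent is pulled to the right.  Hence transitivity occurs within a time that
  depends only on \<open>n\<close>, and from then on the graph is constant, so that it is determined by a
  prefix of bounded length.\<close>

section \<open>Neighbourhoods and the displacement of an agent\<close>

lemma finite_agents [simp]: "finite (agents n)"
  by (simp add: agents_def)

lemma card_agents [simp]: "card (agents n) = n"
  by (simp add: agents_def)

lemma finite_neighbours [simp]: "finite (neighbours n \<epsilon> x i)"
  by (simp add: neighbours_def)

lemma neighbours_subset_agents: "neighbours n \<epsilon> x i \<subseteq> agents n"
  by (auto simp: neighbours_def)

lemma card_neighbours_le: "card (neighbours n \<epsilon> x i) \<le> n"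
  using card_mono[OF finite_agents neighbours_subset_agents] by simp

lemma self_in_neighbours: "i \<in> agents n \<Longrightarrow> 0 \<le> \<epsilon> \<Longrightarrow> i \<in> neighbours n \<epsilon> x i"
  by (simp add: neighbours_def)

lemma card_neighbours_pos: "i \<in> agents n \<Longrightarrow> 0 \<le> \<epsilon> \<Longrightarrow> 0 < card (neighbours n \<epsilon> x i)"
  using self_in_neighbours by (fastforce simp: card_gt_0_iff)

text \<open>A neighbourhood contains its own agent, so its size is nonzero and clears the
  denominator of the mean. The energy and displacement estimates use this form.\<close>

lemma bc_step_displacement:
  assumes "i \<in> agents n" "0 \<le> \<epsilon>"
  shows "real (card (neighbours n \<epsilon> x i)) * (bc_step n \<epsilon> x i - x i)
    = (\<Sum>j\<in>neighbours n \<epsilon> x i. x j - x i)"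
  using assms card_neighbours_pos[OF assms, of x]
  by (simp add: bc_step_def sum_subtractf algebra_simps)


section \<open>Decrease of the energy\<close>

text \<open>The truncation makes appearing and vanishing edges harmless: after a step, either entry
  of the minimum is an upper bound, so each pair may use the one that matches its status before the
  step.\<close>

definition energy :: "nat \<Rightarrow> real \<Rightarrow> config \<Rightarrow> real" where
  "energy n \<epsilon> x = (\<Sum>i\<in>agents n. \<Sum>j\<in>agents n. min ((x i - x j)\<^sup>2) (\<epsilon>\<^sup>2))"

lemma energy_nonneg: "0 \<le> energy n \<epsilon> x"
  unfolding energy_def by (intro sum_nonneg) simp

lemma energy_le: "energy n \<epsilon> x \<le> (real n)\<^sup>2 * \<epsilon>\<^sup>2"
proof -
  have "energy n \<epsilon> x \<le> (\<Sum>i\<in>agents n. \<Sum>j\<in>agents n. \<epsilon>\<^sup>2)"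
    unfolding energy_def by (intro sum_mono) simp
  then show ?thesis
    by (simp add: power2_eq_square)
qed

text \<open>Squares are expanded along the old edges. The terms weighted by a single
  \<open>D i\<close> or \<open>D j\<close> cancel in the sum because each agent moves to the mean of
  its neighbours; what remains is a sum of squares whose diagonal is the claimed gain.\<close>

lemma energy_bc_step:
  assumes \<epsilon>: "0 \<le> \<epsilon>"
  shows "energy n \<epsilon> (bc_step n \<epsilon> x) + 4 * (\<Sum>i\<in>agents n. (bc_step n \<epsilon> x i - x i)\<^sup>2) \<le> energy n \<epsilon> x"
proof -
  define y where "y = bc_step n \<epsilon> x"
  define D where "D i = y i - x i" for i
  define a :: "nat \<Rightarrow> nat \<Rightarrow> real" where "a i j = (if \<bar>x j - x i\<bar> \<le> \<epsilon> then 1 else 0)" for i j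
  have balance: "(\<Sum>j\<in>agents n. a i j * (x j - x i - D i)) = 0" if "i \<in> agents n" for i
  proof -
    have "(\<Sum>j\<in>agents n. a i j * (x j - x i - D i)) = (\<Sum>j\<in>neighbours n \<epsilon> x i. x j - x i - D i)"
      by (rule sum.mono_neutral_cong_right) (auto simp: a_def neighbours_def)
    also have "\<dots> = 0"
      using bc_step_displacement[OF that \<epsilon>, of x] by (simp add: sum_subtractf right_diff_distrib D_def y_def)
    finally show ?thesis .
  qed
  \<comment> \<open>Along an edge this is an exact identity for the squares. Without an edge
    \<open>a i j\<close> and \<open>a j i\<close> vanish, and the right side is
    \<open>\<epsilon>\<^sup>2\<close>.\<close>
  have pointwise: "min ((y i - y j)\<^sup>2) (\<epsilon>\<^sup>2) \<le> min ((x i - x j)\<^sup>2) (\<epsilon>\<^sup>2)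
      - (2 * D i * (a i j * (x j - x i - D i)) + 2 * D j * (a j i * (x i - x j - D j))
         + a i j * (D i + D j)\<^sup>2)" for i j
  proof (cases "\<bar>x j - x i\<bar> \<le> \<epsilon>")
    case True
    then have "(x i - x j)\<^sup>2 \<le> \<epsilon>\<^sup>2"
      using \<epsilon> by (metis abs_le_square_iff abs_minus_commute abs_of_nonneg)
    moreover have "(x i - x j)\<^sup>2 - (y i - y j)\<^sup>2
        = 2 * D i * (x j - x i - D i) + 2 * D j * (x i - x j - D j) + (D i + D j)\<^sup>2"
      by (simp add: D_def power2_eq_square algebra_simps)
    ultimately show ?thesis
      using True by (simp add: a_def abs_minus_commute min_def)
  next
    case False
    then have "\<epsilon>\<^sup>2 \<le> (x i - x j)\<^sup>2"
      using \<epsilon> by (metis abs_le_square_iff abs_minus_commute abs_of_nonneg linear)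
    then show ?thesis
      using False by (simp add: a_def abs_minus_commute)
  qed
  have first: "(\<Sum>i\<in>agents n. \<Sum>j\<in>agents n. 2 * D i * (a i j * (x j - x i - D i))) = 0"
    using balance by (simp add: sum_distrib_left[symmetric])
  have second: "(\<Sum>i\<in>agents n. \<Sum>j\<in>agents n. 2 * D j * (a j i * (x i - x j - D j))) = 0"
    using first by (subst sum.swap)
  \<comment> \<open>Only the terms with \<open>j = i\<close> are kept.\<close>
  have third: "4 * (\<Sum>i\<in>agents n. (D i)\<^sup>2) \<le> (\<Sum>i\<in>agents n. \<Sum>j\<in>agents n. a i j * (D i + D j)\<^sup>2)"
    unfolding sum_distrib_left
  proof (rule sum_mono)
    fix i assume i: "i \<in> agents n"
    have "4 * (D i)\<^sup>2 = a i i * (D i + D i)\<^sup>2"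
      using \<epsilon> by (simp add: a_def power2_eq_square)
    also have "\<dots> \<le> (\<Sum>j\<in>agents n. a i j * (D i + D j)\<^sup>2)"
      using i by (intro member_le_sum) (auto simp: a_def)
    finally show "4 * (D i)\<^sup>2 \<le> (\<Sum>j\<in>agents n. a i j * (D i + D j)\<^sup>2)" .
  qed
  have "energy n \<epsilon> y \<le> (\<Sum>i\<in>agents n. \<Sum>j\<in>agents n. min ((x i - x j)\<^sup>2) (\<epsilon>\<^sup>2)
      - (2 * D i * (a i j * (x j - x i - D i)) + 2 * D j * (a j i * (x i - x j - D j))
         + a i j * (D i + D j)\<^sup>2))"
    unfolding energy_def by (intro sum_mono pointwise)
  also have "\<dots> = energy n \<epsilon> x - (\<Sum>i\<in>agents n. \<Sum>j\<in>agents n. a i j * (D i + D j)\<^sup>2)"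
    using first second by (simp add: sum_subtractf sum.distrib energy_def)
  finally show ?thesis
    using third by (simp add: D_def y_def)
qed


section \<open>Transitive influence relations\<close>

text \<open>For \<epsilon> \<ge> 0 the influence relation is reflexive and symmetric, so
  transitivity means that the graph is a disjoint union of cliques.\<close>

definition settled :: "nat \<Rightarrow> real \<Rightarrow> config \<Rightarrow> bool" where
  "settled n \<epsilon> x \<longleftrightarrow>
     (\<forall>i\<in>agents n. \<forall>j\<in>neighbours n \<epsilon> x i. neighbours n \<epsilon> x j \<subseteq> neighbours n \<epsilon> x i)"

text \<open>A failure of transitivity along \<open>i\<close>, \<open>j\<close>, \<open>k\<close> is
  by symmetry also one along \<open>k\<close>, \<open>j\<close>, \<open>i\<close>, so the far end
  may be taken on the right.\<close>

lemma not_settled_rightward: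
  assumes "\<not> settled n \<epsilon> x"
  obtains p j k where "p \<in> agents n" "j \<in> neighbours n \<epsilon> x p" "k \<in> neighbours n \<epsilon> x j" "x p + \<epsilon> < x k"
proof -
  from assms obtain i j k where
    *: "i \<in> agents n" "j \<in> neighbours n \<epsilon> x i" "k \<in> neighbours n \<epsilon> x j" "k \<notin> neighbours n \<epsilon> x i"
    by (auto simp: settled_def)
  then consider "x i + \<epsilon> < x k" | "x k + \<epsilon> < x i"
    by (fastforce simp: neighbours_def)
  then show thesis
  proof cases
    case 1
    then show thesis using * that by blast
  next
    case 2
    moreover have "k \<in> agents n" "j \<in> neighbours n \<epsilon> x k" "i \<in> neighbours n \<epsilon> x j"
      using * by (auto simp: neighbours_def abs_minus_commute)
    ultimately show thesis using that by blast
  qed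
qed

text \<open>If every agent moves by less than \<open>\<delta>\<close>, then \<open>j\<close> is
  within \<open>n * \<delta>\<close> of \<open>p\<close>, and hence \<open>k\<close> within
  \<open>n * (\<delta> + n * \<delta>)\<close>. The constant is chosen to make this equal to
  \<epsilon>, which contradicts the choice of \<open>k\<close>.\<close>

lemma not_settled_displacement:
  assumes \<epsilon>: "0 \<le> \<epsilon>" and ns: "\<not> settled n \<epsilon> x"
  shows "\<exists>i\<in>agents n. \<epsilon> / (real n * (real n + 1)) \<le> \<bar>bc_step n \<epsilon> x i - x i\<bar>"
proof (rule ccontr)
  define \<delta> where "\<delta> = \<epsilon> / (real n * (real n + 1))"
  assume "\<not> ?thesis"
  then have small: "\<bar>bc_step n \<epsilon> x i - x i\<bar> < \<delta>" if "i \<in> agents n" for i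
    using that by (auto simp: \<delta>_def not_le)
  define S where "S = {p \<in> agents n. \<exists>j\<in>neighbours n \<epsilon> x p. \<exists>k\<in>neighbours n \<epsilon> x j. x p + \<epsilon> < x k}"
  from ns obtain p j k where "p \<in> agents n" "j \<in> neighbours n \<epsilon> x p"
    "k \<in> neighbours n \<epsilon> x j" "x p + \<epsilon> < x k"
    by (rule not_settled_rightward)
  then have S: "finite S" "S \<noteq> {}"
    by (auto simp: S_def)
  obtain p where "p \<in> S" and min: "\<And>q. q \<in> S \<Longrightarrow> x p \<le> x q"
    using arg_min_if_finite[OF S, of x] that[of "arg_min_on x S"] by (simp add: not_less)
  then obtain j k where p: "p \<in> agents n" and j: "j \<in> neighbours n \<epsilon> x p"
    and k: "k \<in> neighbours n \<epsilon> x j" and pk: "x p + \<epsilon> < x k"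
    by (auto simp: S_def)
  have j_agent: "j \<in> agents n" and pj: "x p \<le> x j"
    using j k pk by (auto simp: neighbours_def)
  have n: "0 < n"
    using p by (auto simp: agents_def)
  \<comment> \<open>A neighbour \<open>q\<close> further left would itself belong to
    \<open>S\<close>, by the path \<open>q\<close>, \<open>p\<close>, \<open>j\<close> or by the
    path \<open>q\<close>, \<open>j\<close>, \<open>k\<close>.\<close>
  have leftmost: "x p \<le> x q" if q: "q \<in> neighbours n \<epsilon> x p" for q
  proof (rule ccontr)
    assume less: "\<not> x p \<le> x q"
    have qa: "q \<in> agents n" and pq: "p \<in> neighbours n \<epsilon> x q"
      using q p by (auto simp: neighbours_def abs_minus_commute)
    have "q \<in> S"
    proof (cases "x q + \<epsilon> < x j")
      case True
      then show ?thesis using qa pq j by (auto simp: S_def)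
    next
      case False
      then have "j \<in> neighbours n \<epsilon> x q"
        using less pj j_agent \<epsilon> by (simp add: neighbours_def)
      moreover have "x q + \<epsilon> < x k"
        using pk less by simp
      ultimately show ?thesis using qa k by (auto simp: S_def)
    qed
    then show False using min less by blast
  qed
  have near: "x j - x p \<le> real n * \<delta>"
  proof -
    \<comment> \<open>By \<open>leftmost\<close> all summands are nonnegative, so one of them is at
      most the sum.\<close>
    have "x j - x p \<le> (\<Sum>q\<in>neighbours n \<epsilon> x p. x q - x p)"
      using j leftmost by (intro member_le_sum[where f = "\<lambda>q. x q - x p"]) auto
    also have "\<dots> = real (card (neighbours n \<epsilon> x p)) * (bc_step n \<epsilon> x p - x p)"
      using bc_step_displacement[OF p \<epsilon>, of x] by simp
    also have "\<dots> \<le> real (card (neighbours n \<epsilon> x p)) * \<delta>"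
      using small[OF p] by (intro mult_left_mono) auto
    also have "\<dots> \<le> real n * \<delta>"
      using small[OF p] card_neighbours_le[of n \<epsilon> x p] by (intro mult_right_mono) auto
    finally show ?thesis .
  qed
  \<comment> \<open>Since \<open>p\<close> is not to the right of \<open>j\<close>, a neighbour of
    \<open>j\<close> to the left of \<open>p\<close> would also be a neighbour of
    \<open>p\<close>.\<close>
  have right: "x p \<le> x m" if "m \<in> neighbours n \<epsilon> x j" for m
  proof (rule ccontr)
    assume "\<not> x p \<le> x m"
    then have "m \<in> neighbours n \<epsilon> x p"
      using that pj by (auto simp: neighbours_def)
    then show False using leftmost \<open>\<not> x p \<le> x m\<close> by blast
  qed
  have "x k - x p \<le> (\<Sum>m\<in>neighbours n \<epsilon> x j. x m - x p)"
    using k right by (intro member_le_sum[where f = "\<lambda>m. x m - x p"]) auto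
  also have "\<dots> = (\<Sum>m\<in>neighbours n \<epsilon> x j. x m - x j) + real (card (neighbours n \<epsilon> x j)) * (x j - x p)"
    by (simp add: sum_subtractf algebra_simps)
  also have "\<dots> = real (card (neighbours n \<epsilon> x j)) * (bc_step n \<epsilon> x j - x j + (x j - x p))"
    using bc_step_displacement[OF j_agent \<epsilon>, of x] by (simp add: algebra_simps)
  also have "\<dots> \<le> real (card (neighbours n \<epsilon> x j)) * (\<delta> + real n * \<delta>)"
    using small[OF j_agent] near by (intro mult_left_mono) auto
  also have "\<dots> \<le> real n * (\<delta> + real n * \<delta>)"
    using small[OF p] card_neighbours_le[of n \<epsilon> x j] by (intro mult_right_mono) auto
  also have "\<dots> = \<delta> * (real n * (real n + 1))"
    by (simp add: algebra_simps)
  also have "\<dots> = \<epsilon>"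
    using n by (simp add: \<delta>_def)
  finally show False
    using pk by simp
qed

text \<open>Were \<open>p\<close> in range of \<open>j\<close>, transitivity would join
  \<open>i\<close> to \<open>j\<close>. So \<open>p\<close> stays out of range on the left of
  \<open>j\<close>, and the same argument replaces \<open>j\<close> by \<open>q\<close>: whole
  cliques are more than \<epsilon> apart.\<close>

lemma settled_separated:
  assumes s: "settled n \<epsilon> x" and \<epsilon>: "0 \<le> \<epsilon>" and "i \<in> agents n" "j \<in> agents n" and ij: "x i + \<epsilon> < x j"
    and p: "p \<in> neighbours n \<epsilon> x i" and q: "q \<in> neighbours n \<epsilon> x j"
  shows "x p + \<epsilon> < x q"
proof -
  have agents: "p \<in> agents n" "q \<in> agents n"
    using p q by (auto simp: neighbours_def)
  have ip: "i \<in> neighbours n \<epsilon> x p" and jq: "j \<in> neighbours n \<epsilon> x q"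
    using p q assms by (auto simp: neighbours_def abs_minus_commute)
  have "p \<notin> neighbours n \<epsilon> x j"
  proof
    assume "p \<in> neighbours n \<epsilon> x j"
    with s ip assms have "i \<in> neighbours n \<epsilon> x j" by (auto simp: settled_def)
    then show False using ij by (auto simp: neighbours_def)
  qed
  then have pj: "x p + \<epsilon> < x j"
    using p ij agents by (auto simp: neighbours_def)
  have "q \<notin> neighbours n \<epsilon> x p"
  proof
    assume "q \<in> neighbours n \<epsilon> x p"
    with s jq agents have "j \<in> neighbours n \<epsilon> x p" by (auto simp: settled_def)
    then show False using pj by (auto simp: neighbours_def)
  qed
  then show ?thesis
    using q pj agents by (auto simp: neighbours_def)
qed

text \<open>Each mean lies between the extremes of its own clique, and the gap between the two
  cliques exceeds \<epsilon>.\<close>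

lemma settled_bc_step_separated:
  assumes s: "settled n \<epsilon> x" and \<epsilon>: "0 \<le> \<epsilon>" and i: "i \<in> agents n" and j: "j \<in> agents n"
    and ij: "x i + \<epsilon> < x j"
  shows "bc_step n \<epsilon> x i + \<epsilon> < bc_step n \<epsilon> x j"
proof -
  let ?A = "neighbours n \<epsilon> x i" and ?B = "neighbours n \<epsilon> x j"
  define l where "l = Max (x ` ?A)"
  define r where "r = Min (x ` ?B)"
  have ne: "?A \<noteq> {}" "?B \<noteq> {}"
    using self_in_neighbours i j \<epsilon> by blast+
  have "l \<in> x ` ?A" "r \<in> x ` ?B"
    unfolding l_def r_def using ne by (auto intro!: Max_in Min_in)
  then have lr: "l + \<epsilon> < r"
    using settled_separated[OF s \<epsilon> i j ij] by auto
  have "bc_step n \<epsilon> x i \<le> l"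
  proof -
    have "(\<Sum>p\<in>?A. x p) \<le> real (card ?A) * l"
      by (intro sum_bounded_above) (auto simp: l_def)
    then show ?thesis
      using i card_neighbours_pos[OF i \<epsilon>, of x] by (simp add: bc_step_def field_simps)
  qed
  moreover have "r \<le> bc_step n \<epsilon> x j"
  proof -
    have "real (card ?B) * r \<le> (\<Sum>p\<in>?B. x p)"
      by (intro sum_bounded_below) (auto simp: r_def)
    then show ?thesis
      using j card_neighbours_pos[OF j \<epsilon>, of x] by (simp add: bc_step_def field_simps)
  qed
  ultimately show ?thesis using lr by linarith
qed

lemma settled_neighbours_eq:
  assumes "settled n \<epsilon> x" "i \<in> agents n" "j \<in> neighbours n \<epsilon> x i"
  shows "neighbours n \<epsilon> x j = neighbours n \<epsilon> x i"
proof -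
  have "j \<in> agents n" "i \<in> neighbours n \<epsilon> x j"
    using assms by (auto simp: neighbours_def abs_minus_commute)
  then show ?thesis
    using assms by (auto simp: settled_def)
qed

text \<open>Members of one clique average over the same set and thus meet in a point, while
  different cliques remain separated.\<close>

lemma settled_neighbours_bc_step:
  assumes s: "settled n \<epsilon> x" and \<epsilon>: "0 \<le> \<epsilon>" and i: "i \<in> agents n"
  shows "neighbours n \<epsilon> (bc_step n \<epsilon> x) i = neighbours n \<epsilon> x i"
proof -
  have "\<bar>bc_step n \<epsilon> x j - bc_step n \<epsilon> x i\<bar> \<le> \<epsilon> \<longleftrightarrow> \<bar>x j - x i\<bar> \<le> \<epsilon>" if j: "j \<in> agents n" for j
  proof (cases "\<bar>x j - x i\<bar> \<le> \<epsilon>")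
    case True
    then have "neighbours n \<epsilon> x j = neighbours n \<epsilon> x i"
      using settled_neighbours_eq[OF s i] j by (simp add: neighbours_def)
    then have "bc_step n \<epsilon> x j = bc_step n \<epsilon> x i"
      using i j by (simp add: bc_step_def)
    then show ?thesis using True \<epsilon> by simp
  next
    case False
    then consider "x i + \<epsilon> < x j" | "x j + \<epsilon> < x i" by linarith
    then show ?thesis
      using settled_bc_step_separated[OF s \<epsilon> i j] settled_bc_step_separated[OF s \<epsilon> j i] False
      by cases auto
  qed
  then show ?thesis
    by (auto simp: neighbours_def)
qed

lemma settled_bc_step:
  assumes "settled n \<epsilon> x" "0 \<le> \<epsilon>"
  shows "settled n \<epsilon> (bc_step n \<epsilon> x)"
proof -
  have "neighbours n \<epsilon> (bc_step n \<epsilon> x) j \<subseteq> neighbours n \<epsilon> (bc_step n \<epsilon> x) i"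
    if i: "i \<in> agents n" and "j \<in> neighbours n \<epsilon> (bc_step n \<epsilon> x) i" for i j
  proof -
    have "j \<in> neighbours n \<epsilon> x i" "j \<in> agents n"
      using that settled_neighbours_bc_step[OF assms i] neighbours_subset_agents by blast+
    then show ?thesis
      using settled_neighbours_bc_step[OF assms] settled_neighbours_eq[OF assms(1) i] i by simp
  qed
  then show ?thesis
    by (simp add: settled_def)
qed


section \<open>Finiteness\<close>

lemma influence_edges_neighbours:
  "influence_edges n P t =
    {{i, j} | i j. i \<in> agents n \<and> j \<in> neighbours n (snd P) (bc_config n P t) i \<and> i \<noteq> j}"
  by (simp add: influence_edges_def neighbours_def abs_minus_commute conj_ac)

lemma settled_influence_edges:
  assumes "settled n (snd P) (bc_config n P t)" and \<epsilon>: "0 \<le> snd P" and "t \<le> u"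
  shows "influence_edges n P u = influence_edges n P t"
proof -
  have "settled n (snd P) (bc_config n P u) \<and> influence_edges n P u = influence_edges n P t"
    using \<open>t \<le> u\<close>
  proof (induction u rule: dec_induct)
    case (step u)
    then show ?case
      using settled_bc_step[OF _ \<epsilon>] settled_neighbours_bc_step[OF _ \<epsilon>]
      by (simp add: influence_edges_neighbours cong: conj_cong)
  qed (use assms in simp)
  then show ?thesis ..
qed

text \<open>Each of the \<open>T + 1\<close> times up to \<open>T\<close> costs at least
  \<open>4 * \<delta>\<^sup>2\<close> of an energy that starts at no more than
  \<open>n\<^sup>2 * \<epsilon>\<^sup>2\<close> and never becomes negative.\<close>

lemma not_settled_duration:
  assumes \<epsilon>: "0 \<le> snd P" and ns: "\<And>t. t \<le> T \<Longrightarrow> \<not> settled n (snd P) (bc_config n P t)"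
  shows "T < n ^ 4 * (n + 1) ^ 2"
proof -
  define \<epsilon> where "\<epsilon> = snd P"
  define \<delta> where "\<delta> = \<epsilon> / (real n * (real n + 1))"
  define E where "E t = energy n \<epsilon> (bc_config n P t)" for t
  have "0 \<le> \<delta>"
    using \<epsilon> by (simp add: \<delta>_def \<epsilon>_def)
  have "\<not> settled n \<epsilon> (bc_config n P 0)"
    using ns[of 0] by (simp add: \<epsilon>_def)
  then obtain p j k where p: "p \<in> agents n" and "j \<in> neighbours n \<epsilon> (bc_config n P 0) p"
    "k \<in> neighbours n \<epsilon> (bc_config n P 0) j" "bc_config n P 0 p + \<epsilon> < bc_config n P 0 k"
    by (rule not_settled_rightward)
  \<comment> \<open>With \<epsilon> = 0 neighbours coincide, so no two-edge path could lead to the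
    right. Positivity allows \<open>\<delta>\<^sup>2\<close> to be cancelled at the end.\<close>
  then have "0 < \<epsilon>"
    using \<epsilon> by (auto simp: neighbours_def \<epsilon>_def)
  have n: "0 < n"
    using p by (auto simp: agents_def)
  have drop: "E (Suc t) + 4 * \<delta>\<^sup>2 \<le> E t" if t: "t \<le> T" for t
  proof -
    let ?x = "bc_config n P t"
    obtain i where i: "i \<in> agents n" "\<delta> \<le> \<bar>bc_step n \<epsilon> ?x i - ?x i\<bar>"
      using not_settled_displacement[OF \<epsilon> ns[OF t]] by (auto simp: \<epsilon>_def \<delta>_def)
    then have "\<delta>\<^sup>2 \<le> (bc_step n \<epsilon> ?x i - ?x i)\<^sup>2"
      using \<open>0 \<le> \<delta>\<close> by (simp add: abs_le_square_iff[symmetric])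
    also have "\<dots> \<le> (\<Sum>i\<in>agents n. (bc_step n \<epsilon> ?x i - ?x i)\<^sup>2)"
      using i by (intro member_le_sum) auto
    finally show ?thesis
      using energy_bc_step[of \<epsilon> n ?x] \<epsilon> by (simp add: E_def \<epsilon>_def)
  qed
  have "E t + real t * (4 * \<delta>\<^sup>2) \<le> E 0" if "t \<le> Suc T" for t
    using that
  proof (induction t)
    case (Suc t)
    then show ?case using drop[of t] by (simp add: algebra_simps)
  qed simp
  from this[of "Suc T"] have "real (Suc T) * (4 * \<delta>\<^sup>2) \<le> (real n)\<^sup>2 * \<epsilon>\<^sup>2"
    using energy_nonneg[of n \<epsilon> "bc_config n P (Suc T)"] energy_le[of n \<epsilon> "bc_config n P 0"]
    by (simp add: E_def)
  \<comment> \<open>The factor 4 is given away for a simpler bound.\<close>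
  then have "real (Suc T) * \<delta>\<^sup>2 \<le> (real n)\<^sup>2 * \<epsilon>\<^sup>2"
    by (smt (verit) mult_left_mono of_nat_0_le_iff zero_le_power2)
  also have "\<dots> = (real n)\<^sup>2 * (\<delta> * (real n * (real n + 1)))\<^sup>2"
    using n by (simp add: \<delta>_def)
  also have "\<dots> = real (n ^ 4 * (n + 1) ^ 2) * \<delta>\<^sup>2"
    by (simp add: power2_eq_square power4_eq_xxxx algebra_simps)
  finally have "real (Suc T) \<le> real (n ^ 4 * (n + 1) ^ 2)"
    by (rule mult_right_le_imp_le) (use \<open>0 < \<epsilon>\<close> n in \<open>simp add: \<delta>_def\<close>)
  then show ?thesis
    by (simp only: of_nat_le_iff Suc_le_eq)
qed

theorem lemma4:
  fixes n :: nat
  assumes "n \<ge> 1"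
  shows "finite (bc_processes n // graph_equivalence n)"
proof -
  define T where "T = n ^ 4 * (n + 1) ^ 2"
  \<comment> \<open>Restricting the graph sequence to the times up to \<open>T\<close> gives an
    extensional function, so \<open>f\<close> takes values in a finite function space.\<close>
  define f where "f P = restrict (influence_edges n P) {..T}" for P
  have eventually_constant: "influence_edges n P t = influence_edges n P (min t T)"
    if "P \<in> bc_processes n" for P t
  proof -
    have \<epsilon>: "0 \<le> snd P"
      using that by (auto simp: bc_processes_def)
    obtain s where s: "s \<le> T" "settled n (snd P) (bc_config n P s)"
    proof (rule ccontr)
      assume "\<not> thesis"
      \<comment> \<open>If no time up to \<open>T\<close> were settled, the duration bound, which is
        \<open>T\<close> itself, would be violated.\<close>
      then have "T < T"
        unfolding T_def by (intro not_settled_duration[OF \<epsilon>]) (use that in \<open>auto simp: T_def\<close>)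
      then show False by simp
    qed
    show ?thesis
    proof (cases "t \<le> T")
      case False
      then show ?thesis
        using settled_influence_edges[OF s(2) \<epsilon>, of t] settled_influence_edges[OF s(2) \<epsilon>, of T] s(1)
        by simp
    qed simp
  qed
  have equivalent_iff: "(P, Q) \<in> graph_equivalence n \<longleftrightarrow> f P = f Q"
    if "P \<in> bc_processes n" "Q \<in> bc_processes n" for P Q
  proof
    assume "f P = f Q"
    then have "f P (min t T) = f Q (min t T)" for t
      by simp
    then have "influence_edges n P (min t T) = influence_edges n Q (min t T)" for t
      by (simp add: f_def)
    then show "(P, Q) \<in> graph_equivalence n"
      using that eventually_constant[OF that(1)] eventually_constant[OF that(2)]
      by (simp add: graph_equivalence_def influence_graph_def)
  qed (auto simp: graph_equivalence_def influence_graph_def f_def intro: restrict_ext)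
  have "f ` bc_processes n \<subseteq> {..T} \<rightarrow>\<^sub>E Pow (Pow (agents n))"
    by (auto simp: f_def influence_edges_def)
  then have "finite (f ` bc_processes n)"
    by (rule finite_subset) (intro finite_PiE; simp)
  \<comment> \<open>Every class is a fibre of \<open>f\<close>, so there are no more classes than
    values of \<open>f\<close>.\<close>
  moreover have "bc_processes n // graph_equivalence n
      \<subseteq> (\<lambda>g. {Q \<in> bc_processes n. g = f Q}) ` f ` bc_processes n"
  proof
    fix C assume "C \<in> bc_processes n // graph_equivalence n"
    then obtain P where P: "P \<in> bc_processes n" and "C = graph_equivalence n `` {P}"
      by (auto simp: quotient_def)
    then have "C = {Q \<in> bc_processes n. f P = f Q}"
      using equivalent_iff[OF P] by (auto simp: graph_equivalence_def)
    then show "C \<in> (\<lambda>g. {Q \<in> bc_processes n. g = f Q}) ` f ` bc_processes n"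
      using P by blast
  qed
  ultimately show ?thesis
    by (meson finite_imageI finite_subset)
qed

end
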